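(* Let $S^n_+$ be the open $n$-dimensional hemisphere of the unit sphere $S^n$ with its standard metric $\sigma_n$. For any $\alpha\ge n$ and any $\psi\in C(\partial S^n_+)$, there is no solution in $C^2(S^n_+)\cap C(\overline{S^n_+})$ to the Dirichlet problem $$\operatorname{div}\Big(\frac{Du}{\omega}\Big)=\frac{\alpha}{\omega}\ \text{ for } x\in S^n_+,\quad \omega=\sqrt{1+|Du|^2},\qquad u(x)=\psi(x)\ \text{ for } x\in\partial S^n_+ .$$
   Context: $\operatorname{div}$ and $D$ are the divergence and gradient of $(S^n_+,\sigma_n)$. *)

theory Defs
  imports "HOL-Analysis.Analysis"
begin

text \<open>The unit sphere is \<open>sphere 0 1\<close> in a Euclidean space \<open>'a\<close> with \<open>DIM('a) = n + 1\<close>, and its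
  standard metric is the restriction of the inner product of \<open>'a\<close> to the tangent spaces.
  The hemisphere is taken with respect to a pole \<open>e\<close>.\<close>

definition hemisphere :: "'a::euclidean_space \<Rightarrow> 'a set"
  where "hemisphere e = {x \<in> sphere 0 1. 0 < e \<bullet> x}"

definition equator :: "'a::euclidean_space \<Rightarrow> 'a set"
  where "equator e = {x \<in> sphere 0 1. e \<bullet> x = 0}"

definition tangent_space :: "'a::euclidean_space \<Rightarrow> 'a set"
  where "tangent_space x = {v. v \<bullet> x = 0}"

text \<open>The derivative of a map along the sphere is its Frechet derivative within the sphere. The library
  operator \<open>frechet_derivative\<close> chooses some linear map on the whole of \<open>'a\<close>; only its values on
  tangent vectors are determined (\<open>sphere_derivative_unique\<close> below), and only these are used.\<close>

definition sphere_grad :: "('a::euclidean_space \<Rightarrow> real) \<Rightarrow> 'a \<Rightarrow> 'a"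
  where "sphere_grad u x =
    (THE g. g \<in> tangent_space x \<and>
      (\<forall>v\<in>tangent_space x. g \<bullet> v = frechet_derivative u (at x within sphere 0 1) v))"

text \<open>Levi-Civita connection of the induced metric: the tangential part of the derivative of \<open>X\<close>
  in the ambient space.\<close>

definition sphere_nabla :: "('a::euclidean_space \<Rightarrow> 'a) \<Rightarrow> 'a \<Rightarrow> 'a \<Rightarrow> 'a"
  where "sphere_nabla X x v =
    (let w = frechet_derivative X (at x within sphere 0 1) v in w - (w \<bullet> x) *\<^sub>R x)"

definition orthonormal_basis_of :: "'a::euclidean_space set \<Rightarrow> 'a set \<Rightarrow> bool"
  where "orthonormal_basis_of V B \<longleftrightarrow>
    B \<subseteq> V \<and> span B = V \<and> pairwise orthogonal B \<and> (\<forall>b\<in>B. norm b = 1)"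

text \<open>Divergence: the trace of \<open>v \<mapsto> \<nabla>\<^sub>v X\<close> on the tangent space.\<close>

definition sphere_div :: "('a::euclidean_space \<Rightarrow> 'a) \<Rightarrow> 'a \<Rightarrow> real"
  where "sphere_div X x =
    (THE d. \<forall>B. orthonormal_basis_of (tangent_space x) B \<longrightarrow> d = (\<Sum>b\<in>B. sphere_nabla X x b \<bullet> b))"

definition grad_omega :: "('a::euclidean_space \<Rightarrow> real) \<Rightarrow> 'a \<Rightarrow> real"
  where "grad_omega u x = sqrt (1 + (norm (sphere_grad u x))\<^sup>2)"

definition C2_on_open :: "('a::euclidean_space \<Rightarrow> real) \<Rightarrow> 'a set \<Rightarrow> bool"
  where "C2_on_open F W \<longleftrightarrow> open W \<and>
    (\<exists>(F' :: 'a \<Rightarrow> 'a \<Rightarrow>\<^sub>L real) (F'' :: 'a \<Rightarrow> 'a \<Rightarrow>\<^sub>L 'a \<Rightarrow>\<^sub>L real).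
      (\<forall>x\<in>W. (F has_derivative blinfun_apply (F' x)) (at x) \<and>
              (F' has_derivative blinfun_apply (F'' x)) (at x)) \<and>
      continuous_on W F'')"

text \<open>A function on a subset of Euclidean space, here an open subset of the sphere, is \<open>C\<^sup>2\<close> if near
  each point it is the restriction of a \<open>C\<^sup>2\<close> function on an open set of the ambient space.\<close>

definition C2_on :: "('a::euclidean_space \<Rightarrow> real) \<Rightarrow> 'a set \<Rightarrow> bool"
  where "C2_on u \<Omega> \<longleftrightarrow>
    (\<forall>x\<in>\<Omega>. \<exists>W F. x \<in> W \<and> C2_on_open F W \<and> (\<forall>y \<in> W \<inter> \<Omega>. u y = F y))"


subsection \<open>The definitions are well posed\<close>

lemma sphere_derivative_unique:
  fixes f :: "'a::euclidean_space \<Rightarrow> 'b::real_normed_vector"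
  assumes L: "(f has_derivative L) (at x within sphere 0 1)"
    and M: "(f has_derivative M) (at x within sphere 0 1)"
    and x: "x \<in> sphere 0 1" and v: "v \<in> tangent_space x"
  shows "L v = M v"
proof -
  have lin: "linear L" "linear M"
    using L M has_derivative_linear by blast+
  have unit: "L w = M w" if w: "w \<bullet> x = 0" "norm w = 1" for w
  proof -
    define c where "c = (\<lambda>t::real. cos t *\<^sub>R x + sin t *\<^sub>R w)"
    have "norm (c t) = 1" for t
    proof -
      have "x \<bullet> x = 1" "w \<bullet> w = 1" using x w by (simp_all add: dot_square_norm)
      then have "c t \<bullet> c t = 1"
        using w by (simp add: c_def algebra_simps inner_commute flip: power2_eq_square)
      then show ?thesis by (simp add: norm_eq_sqrt_inner)
    qed
    then have sub: "range c \<subseteq> sphere 0 1" by auto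
    have c0: "c 0 = x" by (simp add: c_def)
    have c: "(c has_derivative (\<lambda>h. h *\<^sub>R w)) (at 0)"
      unfolding c_def by (auto intro!: derivative_eq_intros)
    have "(f has_derivative L) (at (c 0) within range c)" "(f has_derivative M) (at (c 0) within range c)"
      using L M sub c0 has_derivative_subset by metis+
    then have "((f \<circ> c) has_derivative (L \<circ> (\<lambda>h. h *\<^sub>R w))) (at 0)"
      "((f \<circ> c) has_derivative (M \<circ> (\<lambda>h. h *\<^sub>R w))) (at 0)"
      using diff_chain_within[of c _ 0 UNIV] c by blast+
    then have "L \<circ> (\<lambda>h. h *\<^sub>R w) = M \<circ> (\<lambda>h. h *\<^sub>R w)"
      by (rule has_derivative_unique)
    then show ?thesis by (auto dest!: fun_cong[where x=1])
  qed
  show ?thesis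
  proof (cases "v = 0")
    case True
    then show ?thesis using lin by (simp add: linear_0)
  next
    case False
    then have "L (v /\<^sub>R norm v) = M (v /\<^sub>R norm v)"
      using v by (intro unit) (auto simp: tangent_space_def)
    then show ?thesis using lin False by (simp add: linear_cmul)
  qed
qed

lemma sphere_frechet_derivative:
  fixes f :: "'a::euclidean_space \<Rightarrow> 'b::real_normed_vector"
  assumes "(f has_derivative L) (at x within sphere 0 1)"
    and "x \<in> sphere 0 1" and "v \<in> tangent_space x"
  shows "frechet_derivative f (at x within sphere 0 1) v = L v"
  using assms sphere_derivative_unique frechet_derivative_works differentiableI by metis

lemma sphere_grad_eqI:
  assumes L: "(u has_derivative L) (at x within sphere 0 1)" and x: "x \<in> sphere 0 1"
    and g: "g \<in> tangent_space x" "\<And>v. v \<in> tangent_space x \<Longrightarrow> g \<bullet> v = L v"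
  shows "sphere_grad u x = g"
  unfolding sphere_grad_def
proof (rule the_equality)
  show "g \<in> tangent_space x \<and>
      (\<forall>v\<in>tangent_space x. g \<bullet> v = frechet_derivative u (at x within sphere 0 1) v)"
    using g sphere_frechet_derivative[OF L x] by simp
next
  fix h assume h: "h \<in> tangent_space x \<and>
      (\<forall>v\<in>tangent_space x. h \<bullet> v = frechet_derivative u (at x within sphere 0 1) v)"
  have d: "h - g \<in> tangent_space x"
    using h g by (simp add: tangent_space_def inner_diff_left)
  then have "(h - g) \<bullet> (h - g) = 0"
    using h g(2) sphere_frechet_derivative[OF L x] by (simp add: inner_diff_left)
  then show "h = g" by simp
qed

lemma sphere_grad_exists:
  fixes u :: "'a::euclidean_space \<Rightarrow> real"
  assumes L: "(u has_derivative L) (at x within sphere 0 1)" and x: "x \<in> sphere 0 1"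
  shows "sphere_grad u x \<in> tangent_space x"
    and "\<And>v. v \<in> tangent_space x \<Longrightarrow> sphere_grad u x \<bullet> v = L v"
proof -
  define a where "a = (\<Sum>b\<in>Basis. L b *\<^sub>R b)"
  have lin: "linear L" using L has_derivative_linear by blast
  have a: "a \<bullet> v = L v" for v
  proof -
    have "L v = L (\<Sum>b\<in>Basis. (v \<bullet> b) *\<^sub>R b)" by (simp add: euclidean_representation)
    also have "\<dots> = a \<bullet> v"
      using lin by (simp add: linear_sum linear_cmul a_def inner_sum_left inner_commute[of v] mult.commute)
    finally show ?thesis by simp
  qed
  define g where "g = a - (a \<bullet> x) *\<^sub>R x"
  have "x \<bullet> x = 1" using x by (simp add: dot_square_norm)
  then have g1: "g \<in> tangent_space x"
    by (simp add: g_def tangent_space_def inner_diff_left)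
  have g2: "g \<bullet> v = L v" if "v \<in> tangent_space x" for v
  proof -
    have "x \<bullet> v = 0" using that by (simp add: tangent_space_def inner_commute[of x])
    then show ?thesis by (simp add: g_def inner_diff_left a)
  qed
  have "sphere_grad u x = g" by (intro sphere_grad_eqI[OF L x] g1 g2)
  with g1 g2 show "sphere_grad u x \<in> tangent_space x"
    "\<And>v. v \<in> tangent_space x \<Longrightarrow> sphere_grad u x \<bullet> v = L v" by simp_all
qed

lemma orthonormal_basis_of_expand:
  assumes "orthonormal_basis_of V B" "v \<in> V"
  shows "finite B" "v = (\<Sum>b\<in>B. (v \<bullet> b) *\<^sub>R b)"
proof -
  have B: "pairwise orthogonal B" "\<And>b. b \<in> B \<Longrightarrow> norm b = 1" "v \<in> span B"
    using assms by (auto simp: orthonormal_basis_of_def)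
  show fin: "finite B"
    using B(1) by (rule pairwise_orthogonal_imp_finite)
  show "v = (\<Sum>b\<in>B. (v \<bullet> b) *\<^sub>R b)"
    using orthonormal_basis_expand[OF B(1) B(2) B(3) fin] by simp
qed

lemma trace_orthonormal_basis_of:
  fixes A :: "'a::euclidean_space \<Rightarrow> 'a"
  assumes A: "linear A" and B: "orthonormal_basis_of V B" and C: "orthonormal_basis_of V C"
  shows "(\<Sum>b\<in>B. A b \<bullet> b) = (\<Sum>c\<in>C. A c \<bullet> c)"
proof -
  have BV: "B \<subseteq> V" and CV: "C \<subseteq> V" using B C by (auto simp: orthonormal_basis_of_def)
  have "(\<Sum>b\<in>B. A b \<bullet> b) = (\<Sum>b\<in>B. \<Sum>c\<in>C. (b \<bullet> c) * (A c \<bullet> b))"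
  proof (rule sum.cong[OF refl])
    fix b assume "b \<in> B"
    then have "A b = A (\<Sum>c\<in>C. (b \<bullet> c) *\<^sub>R c)"
      using orthonormal_basis_of_expand(2)[OF C] BV by auto
    also have "\<dots> = (\<Sum>c\<in>C. (b \<bullet> c) *\<^sub>R A c)"
      using A by (simp add: linear_sum linear_cmul)
    finally show "A b \<bullet> b = (\<Sum>c\<in>C. (b \<bullet> c) * (A c \<bullet> b))"
      by (simp add: inner_sum_left)
  qed
  also have "\<dots> = (\<Sum>c\<in>C. \<Sum>b\<in>B. (b \<bullet> c) * (A c \<bullet> b))"
    by (rule sum.swap)
  also have "\<dots> = (\<Sum>c\<in>C. A c \<bullet> c)"
  proof (rule sum.cong[OF refl])
    fix c assume "c \<in> C"
    then have "c = (\<Sum>b\<in>B. (c \<bullet> b) *\<^sub>R b)"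
      using orthonormal_basis_of_expand(2)[OF B] CV by auto
    then have "A c \<bullet> c = A c \<bullet> (\<Sum>b\<in>B. (c \<bullet> b) *\<^sub>R b)" by metis
    then show "(\<Sum>b\<in>B. (b \<bullet> c) * (A c \<bullet> b)) = A c \<bullet> c"
      by (simp add: inner_sum_right inner_commute)
  qed
  finally show ?thesis .
qed

lemma sphere_div_eq:
  assumes L: "(X has_derivative L) (at x within sphere 0 1)" and x: "x \<in> sphere 0 1"
    and B: "orthonormal_basis_of (tangent_space x) B"
  shows "sphere_div X x = (\<Sum>b\<in>B. L b \<bullet> b)"
proof -
  have lin: "linear L" using L has_derivative_linear by blast
  have eq: "(\<Sum>c\<in>C. sphere_nabla X x c \<bullet> c) = (\<Sum>b\<in>B. L b \<bullet> b)"
    if C: "orthonormal_basis_of (tangent_space x) C" for C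
  proof -
    have CT: "C \<subseteq> tangent_space x" using C by (simp add: orthonormal_basis_of_def)
    have "sphere_nabla X x c \<bullet> c = L c \<bullet> c" if "c \<in> C" for c
    proof -
      have c: "c \<in> tangent_space x" using that CT by blast
      then have "x \<bullet> c = 0" by (simp add: tangent_space_def inner_commute[of x])
      then show ?thesis
        by (simp add: sphere_nabla_def Let_def inner_diff_left sphere_frechet_derivative[OF L x c])
    qed
    then show ?thesis
      using trace_orthonormal_basis_of[OF lin C B] by simp
  qed
  show ?thesis unfolding sphere_div_def
    by (rule the_equality) (use eq B in auto)
qed

lemma orthonormal_basis_of_tangent_space_exists:
  fixes x :: "'a::euclidean_space"
  shows "\<exists>B. orthonormal_basis_of (tangent_space x) B"
proof -
  have "subspace (tangent_space x)"
    unfolding tangent_space_def by (auto simp: subspace_def inner_left_distrib)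
  from orthonormal_basis_subspace[OF this] show ?thesis
    unfolding orthonormal_basis_of_def by metis
qed

lemma closure_hemisphere:
  fixes e :: "'a::euclidean_space"
  assumes e: "norm e = 1"
  shows "closure (hemisphere e) = hemisphere e \<union> equator e"
proof
  have eq: "hemisphere e \<union> equator e = sphere 0 1 \<inter> {x. e \<bullet> x \<ge> 0}"
    by (auto simp: hemisphere_def equator_def)
  then have "closed (hemisphere e \<union> equator e)"
    by (simp add: closed_Int closed_halfspace_ge)
  then show "closure (hemisphere e) \<subseteq> hemisphere e \<union> equator e"
    by (intro closure_minimal) auto
  have "x \<in> closure (hemisphere e)" if x: "x \<in> equator e" for x
  proof -
    define c where "c = (\<lambda>k::nat. cos (inverse (Suc k)) *\<^sub>R x + sin (inverse (Suc k)) *\<^sub>R e)"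
    have in1: "x \<bullet> x = 1" "e \<bullet> e = 1" "e \<bullet> x = 0"
      using x e by (auto simp: equator_def dot_square_norm)
    have "c k \<in> hemisphere e" for k
    proof -
      have "c k \<bullet> c k = 1"
        using in1 by (simp add: c_def algebra_simps inner_commute flip: power2_eq_square)
      moreover have "0 < sin (inverse (real (Suc k)))"
      proof (rule sin_gt_zero)
        have "inverse (real (Suc k)) \<le> 1" by (simp add: field_simps)
        then show "inverse (real (Suc k)) < pi" using pi_gt3 by linarith
      qed simp
      ultimately show ?thesis
        using in1 by (simp add: hemisphere_def norm_eq_sqrt_inner, simp add: c_def inner_add_right)
    qed
    moreover have "c \<longlonglongrightarrow> cos 0 *\<^sub>R x + sin 0 *\<^sub>R e"
      unfolding c_def by (intro tendsto_intros LIMSEQ_inverse_real_of_nat)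
    ultimately show ?thesis by (auto simp: closure_sequential)
  qed
  then show "hemisphere e \<union> equator e \<subseteq> closure (hemisphere e)"
    using closure_subset by auto
qed

end

theory Submission
  imports Defs
begin

text \<open>Put the graph of \<open>u\<close> into the ambient space as the radial graph of \<open>\<rho> = exp u\<close>, that is, send the point \<open>x\<close> to
  \<open>exp (u x) x\<close>. The area of this hypersurface is \<open>\<integral> exp (n u) \<omega>\<close>, whose Euler-Lagrange equation is
  \<open>div (Du / \<omega>) = n / \<omega>\<close>. So for \<open>\<alpha> = n\<close> the radial graph is minimal. Its height
  \<open>(e \<bullet> x) exp u\<close> over the plane of the equator is then a harmonic function, zero on the boundary
  and positive inside, which the maximum principle forbids; for \<open>\<alpha> > n\<close> the height is strictly
  subharmonic up to first-order terms, which only helps. (The planes \<open>\<rho> (e \<bullet> x) = const\<close>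
  give the solutions \<open>u = const - ln (e \<bullet> x)\<close> for \<open>\<alpha> = n\<close>; they blow up at the equator.)

  To need only the weak maximum principle, the height is perturbed by a multiple of the squared
  distance to the origin, which is strictly subharmonic on a minimal hypersurface:
  \<open>M = (e \<bullet> x) exp u + \<epsilon> exp (2 u)\<close>. On the equator \<open>M\<close> is at most
  \<open>\<epsilon> max exp (2 u)\<close>, so for small \<open>\<epsilon>\<close> its maximum is attained at an interior point \<open>p\<close>. Put
  \<open>g = Du(p)\<close>, \<open>h = e \<bullet> p\<close> and \<open>k = h + 2 \<epsilon> exp (u p) > h\<close>. The first-order condition eliminates the
  tangential part of \<open>e\<close> from the second-order one, and what remains is
  \<open>k D\<^sup>2u(v, v) \<le> h (|v|\<^sup>2 + (g \<bullet> v)\<^sup>2)\<close> for tangent \<open>v\<close> (\<open>hessian_bound_at_max\<close>).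
  The equation says that the trace of \<open>D\<^sup>2u\<close> with respect to the graph metric
  \<open>|v|\<^sup>2 + (g \<bullet> v)\<^sup>2\<close> is \<open>\<alpha>\<close> (\<open>sphere_div_normalized_field\<close>). Tracing the inequality with
  respect to that same metric (\<open>graph_trace_le\<close>) yields \<open>k \<alpha> \<le> h n\<close>, contradicting \<open>k > h > 0\<close>
  and \<open>\<alpha> \<ge> n\<close>.\<close>


section \<open>Second derivative test in one variable\<close>

lemma local_max_derivative_conditions:
  fixes f f' :: "real \<Rightarrow> real"
  assumes f: "\<forall>\<^sub>F t in nhds a. (f has_real_derivative f' t) (at t)"
    and f': "(f' has_real_derivative d) (at a)"
    and max: "\<forall>\<^sub>F t in nhds a. f t \<le> f a"
  shows "f' a = 0" and "d \<le> 0"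
proof -
  obtain r where r: "r > 0" "\<And>t. \<bar>t - a\<bar> < r \<Longrightarrow> (f has_real_derivative f' t) (at t) \<and> f t \<le> f a"
    using eventually_conj[OF f max] unfolding eventually_nhds_metric dist_real_def by blast
  show zero: "f' a = 0"
    using DERIV_local_max[of f "f' a" a r] r by (auto simp: abs_minus_commute)
  show "d \<le> 0"
  proof (rule ccontr)
    assume "\<not> d \<le> 0"
    then obtain s where s: "s > 0" "\<And>h. h > 0 \<Longrightarrow> h < s \<Longrightarrow> f' a < f' (a + h)"
      using DERIV_pos_inc_right[OF f'] by auto
    define q where "q = min r s / 2"
    have q: "0 < q" "q < r" "q < s" using r s by (auto simp: q_def)
    have "f a < f (a + q)"
    proof (rule DERIV_pos_imp_increasing_open[where f = f])
      show "a < a + q" using q by simp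
      show "\<exists>y. DERIV f x :> y \<and> y > 0" if "a < x" "x < a + q" for x
        using r(2)[of x] s(2)[of "x - a"] zero that q by (auto intro!: exI[of _ "f' x"])
      have "isCont f x" if "a \<le> x" "x \<le> a + q" for x
        using r(2)[of x] that q by (auto intro: DERIV_isCont)
      then show "continuous_on {a..a + q} f"
        by (simp add: continuous_at_imp_continuous_on)
    qed
    then show False using r(2)[of "a + q"] q by auto
  qed
qed

section \<open>Gradient and divergence on the hemisphere\<close>

text \<open>Working with the gradient as a vector field makes the tangential gradient of \<open>u\<close> explicit:
  near \<open>p\<close> it is \<open>A y - (A y \<bullet> y) y\<close>, which can be differentiated in the ambient space.\<close>

lemma C2_on_open_gradient:
  fixes F :: "'a::euclidean_space \<Rightarrow> real"
  assumes "C2_on_open F W"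
  obtains A S where
    "\<And>x. x \<in> W \<Longrightarrow> (F has_derivative (\<lambda>v. A x \<bullet> v)) (at x)"
    "\<And>x. x \<in> W \<Longrightarrow> (A has_derivative S x) (at x)"
proof -
  from assms obtain F' :: "'a \<Rightarrow> 'a \<Rightarrow>\<^sub>L real" and F'' :: "'a \<Rightarrow> 'a \<Rightarrow>\<^sub>L 'a \<Rightarrow>\<^sub>L real"
    where F: "\<And>x. x \<in> W \<Longrightarrow> (F has_derivative blinfun_apply (F' x)) (at x)"
      "\<And>x. x \<in> W \<Longrightarrow> (F' has_derivative blinfun_apply (F'' x)) (at x)"
    unfolding C2_on_open_def by blast
  define A where "A x = (\<Sum>b\<in>Basis. F' x b *\<^sub>R b)" for x
  have A: "A x \<bullet> v = F' x v" for x v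
  proof -
    have "F' x v = F' x (\<Sum>b\<in>Basis. (v \<bullet> b) *\<^sub>R b)" by (simp add: euclidean_representation)
    also have "\<dots> = A x \<bullet> v"
      by (simp add: A_def blinfun.sum_right blinfun.scaleR_right inner_sum_left inner_commute[of v] mult.commute)
    finally show ?thesis by simp
  qed
  define S where "S x v = (\<Sum>b\<in>Basis. F'' x v b *\<^sub>R b)" for x v
  show thesis
  proof (rule that)
    show "(F has_derivative (\<lambda>v. A x \<bullet> v)) (at x)" if "x \<in> W" for x
      using F(1)[OF that] A by simp
    show "(A has_derivative S x) (at x)" if "x \<in> W" for x
      unfolding A_def [abs_def] S_def [abs_def] by (auto intro!: derivative_eq_intros F(2)[OF that])
  qed
qed

lemma eventually_hemisphere:
  assumes "x \<in> hemisphere e" "open W" "x \<in> W"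
  shows "\<forall>\<^sub>F y in nhds x. y \<in> W \<and> (y \<in> sphere 0 1 \<longrightarrow> y \<in> hemisphere e)"
proof -
  have "\<forall>\<^sub>F y in nhds x. y \<in> W \<inter> {y. 0 < e \<bullet> y}"
    using assms by (intro eventually_nhds_in_open open_Int open_halfspace_gt) (auto simp: hemisphere_def)
  then show ?thesis by eventually_elim (auto simp: hemisphere_def)
qed

text \<open>The functions \<open>u\<close> and \<open>Du\<close> are only controlled on the hemisphere, whereas the derivatives of
  the sphere calculus are taken within the whole sphere. They agree because the hemisphere is open
  in the sphere.\<close>

lemma has_derivative_within_sphere_cong:
  assumes D: "(f has_derivative D) (at x)" and x: "x \<in> hemisphere e" and W: "open W" "x \<in> W"
    and eq: "\<And>y. y \<in> W \<inter> hemisphere e \<Longrightarrow> u y = f y"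
  shows "(u has_derivative D) (at x within sphere 0 1)"
proof (rule has_derivative_transform_eventually)
  show "(f has_derivative D) (at x within sphere 0 1)"
    using D by (rule has_derivative_at_withinI)
  show "\<forall>\<^sub>F y in at x within sphere 0 1. f y = u y"
    using eventually_hemisphere[OF x W] eq unfolding eventually_at_filter
    by (auto elim!: eventually_mono)
  show "f x = u x" using eq x W by simp
  show "x \<in> sphere 0 1" using x by (simp add: hemisphere_def)
qed

lemma sphere_grad_tangential:
  assumes D: "(F has_derivative (\<lambda>v. a \<bullet> v)) (at x)" and x: "x \<in> hemisphere e" and W: "open W" "x \<in> W"
    and eq: "\<And>y. y \<in> W \<inter> hemisphere e \<Longrightarrow> u y = F y"
  shows "sphere_grad u x = a - (a \<bullet> x) *\<^sub>R x"
proof (rule sphere_grad_eqI)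
  show "(u has_derivative (\<lambda>v. a \<bullet> v)) (at x within sphere 0 1)"
    by (rule has_derivative_within_sphere_cong[OF D x W eq])
  show xs: "x \<in> sphere 0 1" using x by (simp add: hemisphere_def)
  then have "x \<bullet> x = 1" by (simp add: dot_square_norm)
  then show "a - (a \<bullet> x) *\<^sub>R x \<in> tangent_space x"
    by (simp add: tangent_space_def inner_diff_left)
  show "(a - (a \<bullet> x) *\<^sub>R x) \<bullet> v = a \<bullet> v" if "v \<in> tangent_space x" for v
    using that by (simp add: tangent_space_def inner_diff_left inner_commute[of x])
qed

lemma has_derivative_normalized_field:
  fixes g :: "'a::euclidean_space \<Rightarrow> 'a"
  assumes "(g has_derivative H) (at x within T)"
  defines "\<omega> \<equiv> sqrt (1 + (norm (g x))\<^sup>2)"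
  shows "((\<lambda>y. g y /\<^sub>R sqrt (1 + (norm (g y))\<^sup>2)) has_derivative
    (\<lambda>v. H v /\<^sub>R \<omega> - ((g x \<bullet> H v) / \<omega> ^ 3) *\<^sub>R g x)) (at x within T)"
proof -
  have pos: "1 + g x \<bullet> g x > 0" by (smt (verit) inner_ge_zero)
  have \<omega>: "\<omega> = sqrt (1 + g x \<bullet> g x)" by (simp add: \<omega>_def power2_norm_eq_inner)
  have w0: "\<omega> > 0" using pos \<omega> by simp
  have "((\<lambda>y. sqrt (1 + g y \<bullet> g y)) has_derivative (\<lambda>v. (g x \<bullet> H v) / \<omega>)) (at x within T)"
    using pos by (auto intro!: derivative_eq_intros assms(1) simp: \<omega> inner_commute field_simps)
  from Deriv.has_derivative_inverse[OF _ this]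
  have "((\<lambda>y. inverse (sqrt (1 + g y \<bullet> g y))) has_derivative (\<lambda>v. - ((g x \<bullet> H v) / \<omega> ^ 3))) (at x within T)"
    using w0 by (simp add: \<omega>[symmetric] power3_eq_cube divide_inverse mult_ac)
  from has_derivative_scaleR[OF this assms(1)] show ?thesis
    by (simp add: power2_norm_eq_inner \<omega>[symmetric] algebra_simps)
qed

text \<open>The mean curvature operator in nondivergence form. The quadratic term
  \<open>\<Sum>b. (g \<bullet> b) (H b \<bullet> g)\<close> collapses to \<open>H g \<bullet> g\<close> because \<open>g\<close> is tangent, so that it is expanded by
  the tangent basis \<open>B\<close>.\<close>

lemma sphere_div_normalized_field:
  assumes H: "(g has_derivative H) (at x within sphere 0 1)" and x: "x \<in> sphere 0 1"
    and g: "g x \<in> tangent_space x"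
    and B: "orthonormal_basis_of (tangent_space x) B"
    and X: "\<forall>\<^sub>F y in at x within sphere 0 1. X y = g y /\<^sub>R sqrt (1 + (norm (g y))\<^sup>2)"
      "X x = g x /\<^sub>R sqrt (1 + (norm (g x))\<^sup>2)"
  shows "sphere_div X x =
    ((\<Sum>b\<in>B. H b \<bullet> b) - (H (g x) \<bullet> g x) / (1 + (norm (g x))\<^sup>2)) / sqrt (1 + (norm (g x))\<^sup>2)"
proof -
  define \<omega> where "\<omega> = sqrt (1 + (norm (g x))\<^sup>2)"
  have w2: "\<omega>\<^sup>2 = 1 + (norm (g x))\<^sup>2" by (simp add: \<omega>_def)
  have w0: "\<omega> > 0" by (simp add: \<omega>_def add_pos_nonneg)
  have lin: "linear H" using H has_derivative_linear by blast
  have "(X has_derivative (\<lambda>v. H v /\<^sub>R \<omega> - ((g x \<bullet> H v) / \<omega> ^ 3) *\<^sub>R g x)) (at x within sphere 0 1)"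
    by (rule has_derivative_transform_eventually[OF has_derivative_normalized_field[OF H, folded \<omega>_def]])
      (use X x in \<open>auto elim: eventually_mono\<close>)
  then have "sphere_div X x = (\<Sum>b\<in>B. (H b /\<^sub>R \<omega> - ((g x \<bullet> H b) / \<omega> ^ 3) *\<^sub>R g x) \<bullet> b)"
    by (rule sphere_div_eq[OF _ x B])
  also have "\<dots> = (\<Sum>b\<in>B. H b \<bullet> b) / \<omega> - (\<Sum>b\<in>B. (g x \<bullet> b) * (H b \<bullet> g x)) / \<omega> ^ 3"
    unfolding sum_divide_distrib sum_subtractf[symmetric]
    by (rule sum.cong) (simp_all add: inner_diff_left inner_commute[of "g x"] divide_inverse mult_ac)
  also have "(\<Sum>b\<in>B. (g x \<bullet> b) * (H b \<bullet> g x)) = H (\<Sum>b\<in>B. (g x \<bullet> b) *\<^sub>R b) \<bullet> g x"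
    by (simp add: linear_sum[OF lin] linear_cmul[OF lin] inner_sum_left)
  also have "\<dots> = H (g x) \<bullet> g x"
    using orthonormal_basis_of_expand(2)[OF B g] by simp
  finally show ?thesis
    unfolding \<omega>_def[symmetric] w2[symmetric]
    using w0 by (simp add: diff_divide_distrib power2_eq_square power3_eq_cube)
qed

section \<open>Trace with respect to the graph metric\<close>

text \<open>The map \<open>s b = b - \<tau> (g \<bullet> b) g\<close> shrinks the direction of \<open>g\<close> by the factor \<open>1 / \<omega>\<close>. It turns an
  orthonormal basis into a basis orthonormal for the graph metric \<open>|v|\<^sup>2 + (g \<bullet> v)\<^sup>2\<close>, and
  the left-hand side is the trace of \<open>H\<close> in that basis. So it suffices to add up the hypothesis over
  the vectors \<open>s b\<close>, each of which has length one in the graph metric.\<close>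

lemma graph_trace_le:
  fixes H :: "'a::euclidean_space \<Rightarrow> 'a"
  assumes lin: "linear H" and V: "subspace V" and B: "orthonormal_basis_of V B" and g: "g \<in> V"
    and le: "\<And>v. v \<in> V \<Longrightarrow> H v \<bullet> v \<le> c * ((norm v)\<^sup>2 + (g \<bullet> v)\<^sup>2)"
  shows "(\<Sum>b\<in>B. H b \<bullet> b) - (H g \<bullet> g) / (1 + (norm g)\<^sup>2) \<le> c * card B"
proof -
  define \<omega> where "\<omega> = sqrt (1 + g \<bullet> g)"
  \<comment> \<open>The solution of \<open>1 - \<tau> |g|\<^sup>2 = 1 / \<omega>\<close>, in a form that makes sense for \<open>g = 0\<close>.\<close>
  define \<tau> where "\<tau> = 1 / (\<omega> * (\<omega> + 1))"
  define s where "s b = b - (\<tau> * (g \<bullet> b)) *\<^sub>R g" for b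
  have w: "\<omega> > 0" "\<omega>\<^sup>2 = 1 + g \<bullet> g" by (auto simp: \<omega>_def add_pos_nonneg)
  have gg: "g \<bullet> g = \<omega>\<^sup>2 - 1" using w by simp
  have t: "1 - \<tau> * (g \<bullet> g) = 1 / \<omega>" "2 * \<tau> - \<tau>\<^sup>2 * (g \<bullet> g) = 1 / \<omega>\<^sup>2"
    using w(1) unfolding gg \<tau>_def by (simp_all add: divide_simps) (auto simp: algebra_simps power2_eq_square)
  have BV: "B \<subseteq> V" and B1: "\<And>b. b \<in> B \<Longrightarrow> b \<bullet> b = 1"
    using B by (auto simp: orthonormal_basis_of_def dot_square_norm)
  have gexp: "(\<Sum>b\<in>B. (g \<bullet> b) *\<^sub>R b) = g" using orthonormal_basis_of_expand(2)[OF B g] by simp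
  have one: "(norm (s b))\<^sup>2 + (g \<bullet> s b)\<^sup>2 = 1" if "b \<in> B" for b
  proof -
    have "g \<bullet> s b = (g \<bullet> b) * (1 - \<tau> * (g \<bullet> g))" by (simp add: s_def algebra_simps)
    moreover have "s b \<bullet> s b = 1 - (2 * \<tau> - \<tau>\<^sup>2 * (g \<bullet> g)) * (g \<bullet> b)\<^sup>2"
      using B1[OF that] by (simp add: s_def algebra_simps power2_eq_square inner_commute)
    ultimately show ?thesis
      using w(1) by (simp add: t power2_norm_eq_inner power_mult_distrib power_divide)
  qed
  have "(\<Sum>b\<in>B. H (s b) \<bullet> s b) \<le> (\<Sum>b\<in>B. c)"
  proof (rule sum_mono)
    fix b assume b: "b \<in> B"
    then have "s b \<in> V" unfolding s_def using BV g V by (auto intro: subspace_diff subspace_scale)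
    then show "H (s b) \<bullet> s b \<le> c" using le[of "s b"] one[OF b] by simp
  qed
  also have "(\<Sum>b\<in>B. H (s b) \<bullet> s b) =
     (\<Sum>b\<in>B. H b \<bullet> b - \<tau> * ((g \<bullet> b) * (H b \<bullet> g)) - \<tau> * ((g \<bullet> b) * (H g \<bullet> b)) + \<tau>\<^sup>2 * (H g \<bullet> g) * ((g \<bullet> b) * (b \<bullet> g)))"
    by (rule sum.cong)
      (simp_all add: s_def linear_diff[OF lin] linear_cmul[OF lin] algebra_simps power2_eq_square inner_commute)
  also have "\<dots> = (\<Sum>b\<in>B. H b \<bullet> b) - \<tau> * (\<Sum>b\<in>B. (g \<bullet> b) * (H b \<bullet> g))
      - \<tau> * (\<Sum>b\<in>B. (g \<bullet> b) * (H g \<bullet> b)) + \<tau>\<^sup>2 * (H g \<bullet> g) * (\<Sum>b\<in>B. (g \<bullet> b) * (b \<bullet> g))"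
    by (simp add: sum.distrib sum_subtractf sum_distrib_left)
  also have "(\<Sum>b\<in>B. (g \<bullet> b) * (H b \<bullet> g)) = H (\<Sum>b\<in>B. (g \<bullet> b) *\<^sub>R b) \<bullet> g"
    by (simp add: linear_sum[OF lin] linear_cmul[OF lin] inner_sum_left)
  also have "(\<Sum>b\<in>B. (g \<bullet> b) * (H g \<bullet> b)) = H g \<bullet> (\<Sum>b\<in>B. (g \<bullet> b) *\<^sub>R b)"
    by (simp add: inner_sum_right)
  also have "(\<Sum>b\<in>B. (g \<bullet> b) * (b \<bullet> g)) = (\<Sum>b\<in>B. (g \<bullet> b) *\<^sub>R b) \<bullet> g"
    by (simp add: inner_sum_left)
  also have "(\<Sum>b\<in>B. H b \<bullet> b) - \<tau> * (H (\<Sum>b\<in>B. (g \<bullet> b) *\<^sub>R b) \<bullet> g) - \<tau> * (H g \<bullet> (\<Sum>b\<in>B. (g \<bullet> b) *\<^sub>R b))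
      + \<tau>\<^sup>2 * (H g \<bullet> g) * ((\<Sum>b\<in>B. (g \<bullet> b) *\<^sub>R b) \<bullet> g)
      = (\<Sum>b\<in>B. H b \<bullet> b) - (2 * \<tau> - \<tau>\<^sup>2 * (g \<bullet> g)) * (H g \<bullet> g)"
    unfolding gexp by (simp add: algebra_simps)
  finally show ?thesis
    unfolding t w(2) power2_norm_eq_inner by (simp add: mult.commute)
qed

section \<open>The perturbed height at a maximum\<close>

text \<open>Along a great circle through \<open>p\<close> the function \<open>e \<bullet> x\<close> is \<open>h cos t + m sin t\<close>. The first-order
  condition at a maximum determines the unknown slope \<open>m = - k \<phi>' 0\<close> with
  \<open>k = h + 2 \<epsilon> exp (\<phi> 0)\<close>; substituting it into the second derivative cancels all terms in \<open>\<epsilon>\<close> other than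
  the one inside \<open>k\<close>.\<close>

lemma radial_graph_max_on_curve:
  fixes \<phi> \<phi>' :: "real \<Rightarrow> real"
  assumes \<phi>: "\<forall>\<^sub>F t in nhds 0. (\<phi> has_real_derivative \<phi>' t) (at t)"
    and \<phi>': "(\<phi>' has_real_derivative d) (at 0)"
    and max: "\<forall>\<^sub>F t in nhds 0. exp (\<phi> t) * (h * cos t + m * sin t) + \<epsilon> * exp (2 * \<phi> t)
      \<le> exp (\<phi> 0) * h + \<epsilon> * exp (2 * \<phi> 0)"
  shows "(h + 2 * \<epsilon> * exp (\<phi> 0)) * d \<le> h * (1 + (\<phi>' 0)\<^sup>2)"
proof -
  define f where "f t = exp (\<phi> t) * (h * cos t + m * sin t) + \<epsilon> * exp (2 * \<phi> t)" for t
  define f' where "f' t = exp (\<phi> t) * (\<phi>' t * (h * cos t + m * sin t) + (m * cos t - h * sin t))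
    + 2 * \<epsilon> * exp (2 * \<phi> t) * \<phi>' t" for t
  have f: "\<forall>\<^sub>F t in nhds 0. (f has_real_derivative f' t) (at t)"
    using \<phi> by eventually_elim
      (auto simp: f_def [abs_def] f'_def algebra_simps intro!: derivative_eq_intros)
  have \<phi>0: "(\<phi> has_real_derivative \<phi>' 0) (at 0)" using \<phi> by (rule eventually_nhds_x_imp_x)
  define E where "E = exp (\<phi> 0)"
  have E: "E > 0" "exp (2 * \<phi> 0) = E * E" by (simp_all add: E_def exp_double power2_eq_square)
  define d' where "d' = E * (d * h + (\<phi>' 0)\<^sup>2 * h + 2 * \<phi>' 0 * m - h) + 2 * \<epsilon> * E * E * (d + 2 * (\<phi>' 0)\<^sup>2)"
  have cs: "((\<lambda>t. h * cos t + m * sin t) has_real_derivative m) (at 0)"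
    and cs': "((\<lambda>t. m * cos t - h * sin t) has_real_derivative - h) (at 0)"
    by (auto intro!: derivative_eq_intros)
  have ex: "((\<lambda>t. exp (\<phi> t)) has_real_derivative E * \<phi>' 0) (at 0)"
    using DERIV_fun_exp[OF \<phi>0] by (simp add: E_def)
  have ex2: "((\<lambda>t. exp (2 * \<phi> t)) has_real_derivative E * E * (2 * \<phi>' 0)) (at 0)"
    using DERIV_fun_exp[OF DERIV_cmult[OF \<phi>0, of 2]] E by simp
  have f': "(f' has_real_derivative d') (at 0)"
    unfolding f'_def [abs_def]
    by (rule DERIV_cong[OF DERIV_add[OF DERIV_mult[OF ex DERIV_add[OF DERIV_mult[OF \<phi>' cs] cs']]
          DERIV_mult[OF DERIV_cmult[OF ex2] \<phi>']]])
      (unfold E(2) E_def[symmetric] d'_def, simp add: algebra_simps power2_eq_square)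
  have max': "\<forall>\<^sub>F t in nhds 0. f t \<le> f 0" using max by (simp add: f_def)
  have "f' 0 = 0" "d' \<le> 0" using local_max_derivative_conditions[OF f f' max'] by auto
  define k where "k = h + 2 * \<epsilon> * E"
  have "f' 0 = E * (k * \<phi>' 0 + m)"
    unfolding f'_def E(2) E_def[symmetric] k_def by (simp add: E(2) algebra_simps)
  with \<open>f' 0 = 0\<close> E have m: "m = - k * \<phi>' 0" by simp
  have "d' = E * (k * d - h * (1 + (\<phi>' 0)\<^sup>2))"
    unfolding d'_def m k_def by (simp add: algebra_simps power2_eq_square)
  with \<open>d' \<le> 0\<close> E have "k * d - h * (1 + (\<phi>' 0)\<^sup>2) \<le> 0" by (simp add: mult_le_0_iff)
  then show ?thesis by (simp add: k_def E_def)
qed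

text \<open>The term \<open>- A p \<bullet> p\<close> comes from the acceleration \<open>- p\<close> of the great circle. It is what turns the
  ambient Hessian \<open>S\<close> into the Hessian of the sphere.\<close>

lemma great_circle_second_derivative:
  fixes F :: "'a::euclidean_space \<Rightarrow> real" and p v :: 'a
  assumes W: "open W" "p \<in> W"
    and F: "\<And>x. x \<in> W \<Longrightarrow> (F has_derivative (\<lambda>v. A x \<bullet> v)) (at x)"
    and A: "(A has_derivative S) (at p)"
  defines "c \<equiv> \<lambda>t. cos t *\<^sub>R p + sin t *\<^sub>R v" and "c' \<equiv> \<lambda>t. cos t *\<^sub>R v - sin t *\<^sub>R p"
  shows "\<forall>\<^sub>F t in nhds 0. ((\<lambda>t. F (c t)) has_real_derivative A (c t) \<bullet> c' t) (at t)"
    and "((\<lambda>t. A (c t) \<bullet> c' t) has_real_derivative S v \<bullet> v - A p \<bullet> p) (at 0)"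
proof -
  have c: "(c has_derivative (\<lambda>h. h *\<^sub>R c' t)) (at t)" for t
    unfolding c_def c'_def by (auto intro!: derivative_eq_intros simp: algebra_simps)
  have c': "(c' has_derivative (\<lambda>h. h *\<^sub>R (- p))) (at 0)"
    unfolding c'_def by (auto intro!: derivative_eq_intros simp: algebra_simps)
  have c0: "c 0 = p" "c' 0 = v" by (simp_all add: c_def c'_def)
  have "isCont c 0" using c has_derivative_continuous by blast
  then have "\<forall>\<^sub>F t in nhds 0. c t \<in> W"
    using tendsto_at_iff_tendsto_nhds[of c 0] topological_tendstoD[of c p "nhds 0" W] W
    by (simp add: isCont_def c0)
  then show "\<forall>\<^sub>F t in nhds 0. ((\<lambda>t. F (c t)) has_real_derivative A (c t) \<bullet> c' t) (at t)"
  proof eventually_elim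
    case (elim t)
    have "((\<lambda>t. F (c t)) has_derivative (\<lambda>h. A (c t) \<bullet> (h *\<^sub>R c' t))) (at t)"
      by (rule has_derivative_compose[OF c F[OF elim]])
    then show ?case by (simp add: has_field_derivative_def mult_commute_abs)
  qed
  have "((\<lambda>t. A (c t)) has_derivative (\<lambda>h. S (h *\<^sub>R v))) (at 0)"
    using has_derivative_compose[OF c[of 0], of A S] A c0 by simp
  from has_derivative_inner[OF this c']
  have "((\<lambda>t. A (c t) \<bullet> c' t) has_derivative (\<lambda>h. A p \<bullet> (h *\<^sub>R (- p)) + S (h *\<^sub>R v) \<bullet> v)) (at 0)"
    by (simp add: c0)
  moreover have "(\<lambda>h. A p \<bullet> (h *\<^sub>R (- p)) + S (h *\<^sub>R v) \<bullet> v) = (*) (S v \<bullet> v - A p \<bullet> p)"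
    using has_derivative_linear[OF A] by (auto simp: linear_cmul algebra_simps)
  ultimately show "((\<lambda>t. A (c t) \<bullet> c' t) has_real_derivative S v \<bullet> v - A p \<bullet> p) (at 0)"
    by (simp add: has_field_derivative_def)
qed

text \<open>The bound on a great circle with unit velocity is homogeneous of degree two in the velocity, so it
  extends to all tangent vectors. Arbitrary lengths are needed because the bound is going to be
  traced with vectors that have length one in the graph metric, not in the sphere.\<close>

lemma hessian_bound_at_max:
  fixes u F :: "'a::euclidean_space \<Rightarrow> real"
  assumes p: "p \<in> hemisphere e" and W: "open W" "p \<in> W"
    and u: "\<And>y. y \<in> W \<inter> hemisphere e \<Longrightarrow> u y = F y"
    and F: "\<And>x. x \<in> W \<Longrightarrow> (F has_derivative (\<lambda>v. A x \<bullet> v)) (at x)"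
    and A: "(A has_derivative S) (at p)"
    and max: "\<And>y. y \<in> hemisphere e \<Longrightarrow>
      exp (u y) * (e \<bullet> y) + \<epsilon> * exp (2 * u y) \<le> exp (u p) * (e \<bullet> p) + \<epsilon> * exp (2 * u p)"
    and v: "v \<in> tangent_space p"
  shows "(e \<bullet> p + 2 * \<epsilon> * exp (u p)) * (S v \<bullet> v - (A p \<bullet> p) * (norm v)\<^sup>2)
    \<le> (e \<bullet> p) * ((norm v)\<^sup>2 + (A p \<bullet> v)\<^sup>2)"
proof -
  have unit: "(e \<bullet> p + 2 * \<epsilon> * exp (u p)) * (S v \<bullet> v - A p \<bullet> p) \<le> (e \<bullet> p) * (1 + (A p \<bullet> v)\<^sup>2)"
    if v: "v \<bullet> p = 0" "v \<bullet> v = 1" for v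
  proof -
    define c where "c t = cos t *\<^sub>R p + sin t *\<^sub>R v" for t
    define c' where "c' t = cos t *\<^sub>R v - sin t *\<^sub>R p" for t
    have D: "\<forall>\<^sub>F t in nhds 0. ((\<lambda>t. F (c t)) has_real_derivative A (c t) \<bullet> c' t) (at t)"
      "((\<lambda>t. A (c t) \<bullet> c' t) has_real_derivative S v \<bullet> v - A p \<bullet> p) (at 0)"
      unfolding c_def c'_def by (rule great_circle_second_derivative[OF W F A]; assumption)+
    have pp: "p \<bullet> p = 1" using p by (simp add: hemisphere_def dot_square_norm)
    have sph: "c t \<in> sphere 0 1" for t
    proof -
      have "c t \<bullet> c t = 1"
        using v pp by (simp add: c_def algebra_simps inner_commute flip: power2_eq_square)
      then show ?thesis by (simp add: norm_eq_sqrt_inner)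
    qed
    have c0: "c 0 = p" "c' 0 = v" by (simp_all add: c_def c'_def)
    have "isCont c 0" unfolding c_def [abs_def] by (intro continuous_intros)
    then have "filterlim c (nhds p) (nhds 0)"
      using tendsto_at_iff_tendsto_nhds[of c 0] by (simp add: isCont_def c0)
    then have ev: "\<forall>\<^sub>F t in nhds 0. c t \<in> W \<inter> hemisphere e"
      using eventually_compose_filterlim[OF eventually_hemisphere[OF p W], of c "nhds 0"] sph
      by (auto elim: eventually_mono)
    have Fp: "F p = u p" using u p W by simp
    have "\<forall>\<^sub>F t in nhds 0. exp (F (c t)) * ((e \<bullet> p) * cos t + (e \<bullet> v) * sin t) + \<epsilon> * exp (2 * F (c t))
      \<le> exp (F (c 0)) * (e \<bullet> p) + \<epsilon> * exp (2 * F (c 0))"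
      using ev
    proof eventually_elim
      case (elim t)
      have "e \<bullet> c t = (e \<bullet> p) * cos t + (e \<bullet> v) * sin t" by (simp add: c_def inner_add_right)
      then show ?case using max[of "c t"] elim u[of "c t"] by (simp add: c0 Fp)
    qed
    from radial_graph_max_on_curve[OF D this] show ?thesis by (simp add: c0 Fp)
  qed
  show ?thesis
  proof (cases "v = 0")
    case True
    then show ?thesis using has_derivative_linear[OF A] by (simp add: linear_0)
  next
    case False
    define r where "r = norm v"
    define w where "w = v /\<^sub>R r"
    have r: "r > 0" "v = r *\<^sub>R w" using False by (auto simp: r_def w_def)
    have "w \<bullet> p = 0" "w \<bullet> w = 1"
      using v False by (auto simp: w_def r_def tangent_space_def dot_square_norm power2_eq_square divide_simps)
    from unit[OF this]
    have "r\<^sup>2 * ((e \<bullet> p + 2 * \<epsilon> * exp (u p)) * (S w \<bullet> w - A p \<bullet> p)) \<le> r\<^sup>2 * ((e \<bullet> p) * (1 + (A p \<bullet> w)\<^sup>2))"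
      by (rule mult_left_mono) simp
    then show ?thesis
      unfolding r_def[symmetric]
      using has_derivative_linear[OF A] by (simp add: r(2) linear_cmul algebra_simps power2_eq_square)
  qed
qed

lemma card_orthonormal_basis_of_tangent_space:
  fixes x :: "'a::euclidean_space"
  assumes "x \<noteq> 0" and B: "orthonormal_basis_of (tangent_space x) B"
  shows "card B = DIM('a) - 1"
proof -
  have "independent B"
    using B by (intro pairwise_orthogonal_independent) (auto simp: orthonormal_basis_of_def)
  then have "card B = dim (tangent_space x)"
    using B by (metis orthonormal_basis_of_def dim_span_eq_card_independent)
  also have "tangent_space x = {v. x \<bullet> v = 0}" by (auto simp: tangent_space_def inner_commute)
  finally show ?thesis using dim_hyperplane[OF \<open>x \<noteq> 0\<close>] by simp
qed

text \<open>This is the maximum principle for the perturbed height. The strict inequality \<open>k > e \<bullet> p\<close>, where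
  \<open>\<epsilon> > 0\<close> enters, is what excludes the borderline case \<open>\<alpha> = n\<close>.\<close>

lemma no_interior_max_of_perturbed_height:
  fixes u :: "'a::euclidean_space \<Rightarrow> real"
  assumes C2: "C2_on u (hemisphere e)" and p: "p \<in> hemisphere e"
    and pde: "sphere_div (\<lambda>y. sphere_grad u y /\<^sub>R grad_omega u y) p = \<alpha> / grad_omega u p"
    and dim: "DIM('a) = n + 1" and \<alpha>: "\<alpha> \<ge> real n" "\<alpha> > 0" and \<epsilon>: "\<epsilon> > 0"
    and max: "\<And>y. y \<in> hemisphere e \<Longrightarrow>
      exp (u y) * (e \<bullet> y) + \<epsilon> * exp (2 * u y) \<le> exp (u p) * (e \<bullet> p) + \<epsilon> * exp (2 * u p)"
  shows False
proof -
  obtain W F where W: "p \<in> W" and F: "C2_on_open F W" and u: "\<And>y. y \<in> W \<inter> hemisphere e \<Longrightarrow> u y = F y"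
    using C2[unfolded C2_on_def, THEN bspec, OF p] by (elim exE conjE) (auto intro: that)
  have oW: "open W" using F by (simp add: C2_on_open_def)
  obtain A S where AS: "\<And>x. x \<in> W \<Longrightarrow> (F has_derivative (\<lambda>v. A x \<bullet> v)) (at x)"
      "\<And>x. x \<in> W \<Longrightarrow> (A has_derivative S x) (at x)"
    using C2_on_open_gradient[OF F] by metis
  have ps: "p \<in> sphere 0 1" and h: "e \<bullet> p > 0" using p by (auto simp: hemisphere_def)
  obtain B where B: "orthonormal_basis_of (tangent_space p) B"
    using orthonormal_basis_of_tangent_space_exists by blast
  have card: "card B = n" using card_orthonormal_basis_of_tangent_space[OF _ B] ps dim by (cases "p = 0") auto
  define g where "g y = A y - (A y \<bullet> y) *\<^sub>R y" for y
  \<comment> \<open>The ambient derivative of \<open>g\<close> at \<open>p\<close>; its tangential part is the Hessian of \<open>u\<close>.\<close>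
  define H where "H v = S p v - (A p \<bullet> v + S p v \<bullet> p) *\<^sub>R p - (A p \<bullet> p) *\<^sub>R v" for v
  have grad: "sphere_grad u y = g y" if "y \<in> W \<inter> hemisphere e" for y
    unfolding g_def using sphere_grad_tangential[OF AS(1) _ oW _ u] that by blast
  have "(g has_derivative H) (at p)"
    unfolding g_def [abs_def] H_def [abs_def]
    by (auto intro!: derivative_eq_intros AS(2)[OF W] simp: algebra_simps)
  then have Dg: "(g has_derivative H) (at p within sphere 0 1)" by (rule has_derivative_at_withinI)
  have lin: "linear H" using has_derivative_linear[OF Dg] .
  have "p \<bullet> p = 1" using ps by (simp add: dot_square_norm)
  then have gT: "g p \<in> tangent_space p" by (simp add: g_def tangent_space_def inner_diff_left)
  have X: "sphere_grad u y /\<^sub>R grad_omega u y = g y /\<^sub>R sqrt (1 + (norm (g y))\<^sup>2)"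
    if "y \<in> W \<inter> hemisphere e" for y
    using grad[OF that] by (simp add: grad_omega_def)
  have ev: "\<forall>\<^sub>F y in at p within sphere 0 1.
      sphere_grad u y /\<^sub>R grad_omega u y = g y /\<^sub>R sqrt (1 + (norm (g y))\<^sup>2)"
    using eventually_hemisphere[OF p oW W] X unfolding eventually_at_filter
    by (auto elim!: eventually_mono)
  have "grad_omega u p > 0" by (simp add: grad_omega_def add_pos_nonneg)
  with sphere_div_normalized_field[OF Dg ps gT B ev X] pde p W
  have eq: "(\<Sum>b\<in>B. H b \<bullet> b) - (H (g p) \<bullet> g p) / (1 + (norm (g p))\<^sup>2) = \<alpha>"
    using grad[of p] by (simp add: grad_omega_def divide_cancel_right)
  define k where "k = e \<bullet> p + 2 * \<epsilon> * exp (u p)"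
  have k: "k > e \<bullet> p" using \<epsilon> by (simp add: k_def)
  have "H v \<bullet> v \<le> ((e \<bullet> p) / k) * ((norm v)\<^sup>2 + (g p \<bullet> v)\<^sup>2)" if v: "v \<in> tangent_space p" for v
  proof -
    have vp: "p \<bullet> v = 0" using v by (simp add: tangent_space_def inner_commute)
    have "H v \<bullet> v = S p v \<bullet> v - (A p \<bullet> p) * (norm v)\<^sup>2"
      by (simp add: H_def inner_diff_left vp power2_norm_eq_inner)
    moreover have "g p \<bullet> v = A p \<bullet> v" by (simp add: g_def inner_diff_left vp)
    ultimately have "k * (H v \<bullet> v) \<le> (e \<bullet> p) * ((norm v)\<^sup>2 + (g p \<bullet> v)\<^sup>2)"
      using hessian_bound_at_max[OF p oW W u AS(1) AS(2)[OF W] max v] unfolding k_def by simp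
    then show ?thesis using k h by (simp add: field_simps)
  qed
  from graph_trace_le[OF lin _ B gT this]
  have "\<alpha> \<le> (e \<bullet> p) / k * n"
    by (simp add: eq card subspace_def tangent_space_def inner_add_left)
  then have "\<alpha> * k \<le> (e \<bullet> p) * n" using k h by (simp add: field_simps)
  also have "\<dots> \<le> (e \<bullet> p) * \<alpha>" using h \<alpha> by simp
  also have "\<dots> < k * \<alpha>" using k \<alpha> by simp
  finally show False by (simp add: mult.commute)
qed

section \<open>Nonexistence of solutions\<close>

theorem theorem6p1:
  fixes e :: "'a::euclidean_space" and n :: nat and \<alpha> :: real and \<psi> :: "'a \<Rightarrow> real"
  assumes "n \<ge> 1" and "DIM('a) = n + 1" and "norm e = 1"
    and "\<alpha> \<ge> real n"
    and "continuous_on (equator e) \<psi>"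
  shows "\<not> (\<exists>u :: 'a \<Rightarrow> real.
      C2_on u (hemisphere e) \<and> continuous_on (closure (hemisphere e)) u \<and>
      (\<forall>x\<in>hemisphere e.
        sphere_div (\<lambda>y. sphere_grad u y /\<^sub>R grad_omega u y) x = \<alpha> / grad_omega u x) \<and>
      (\<forall>x\<in>equator e. u x = \<psi> x))"
proof
  assume "\<exists>u :: 'a \<Rightarrow> real.
      C2_on u (hemisphere e) \<and> continuous_on (closure (hemisphere e)) u \<and>
      (\<forall>x\<in>hemisphere e.
        sphere_div (\<lambda>y. sphere_grad u y /\<^sub>R grad_omega u y) x = \<alpha> / grad_omega u x) \<and>
      (\<forall>x\<in>equator e. u x = \<psi> x)"
  then obtain u where C2: "C2_on u (hemisphere e)" and cont: "continuous_on (closure (hemisphere e)) u"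
    and pde: "\<And>x. x \<in> hemisphere e \<Longrightarrow>
        sphere_div (\<lambda>y. sphere_grad u y /\<^sub>R grad_omega u y) x = \<alpha> / grad_omega u x"
    by blast
  define K where "K = closure (hemisphere e)"
  have e: "e \<in> hemisphere e" using assms(3) by (simp add: hemisphere_def dot_square_norm)
  then have eK: "e \<in> K" unfolding K_def using closure_subset by blast
  have "bounded (hemisphere e)" by (rule bounded_subset[of "sphere 0 1"]) (auto simp: hemisphere_def)
  then have K: "compact K" by (simp add: K_def compact_closure)
  obtain q where q: "q \<in> K" "\<And>y. y \<in> K \<Longrightarrow> u y \<le> u q"
    using continuous_attains_sup[OF K _ cont[folded K_def]] eK by blast
  \<comment> \<open>Chosen so that \<open>\<epsilon> exp (2 u) \<le> exp (u e)\<close> everywhere: on the equator the perturbed height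
    stays below its value at the pole.\<close>
  define \<epsilon> where "\<epsilon> = exp (u e - 2 * u q)"
  have \<epsilon>: "\<epsilon> > 0" by (simp add: \<epsilon>_def)
  define M where "M y = exp (u y) * (e \<bullet> y) + \<epsilon> * exp (2 * u y)" for y
  have "continuous_on K M" unfolding M_def by (intro continuous_intros cont[folded K_def])
  then obtain p where p: "p \<in> K" "\<And>y. y \<in> K \<Longrightarrow> M y \<le> M p"
    using continuous_attains_sup[OF K _] eK by blast
  have "p \<notin> equator e"
  proof
    assume "p \<in> equator e"
    then have "M p = exp (u e + 2 * (u p - u q))"
      by (simp add: M_def equator_def \<epsilon>_def exp_add[symmetric] algebra_simps)
    also have "\<dots> \<le> exp (u e)" using q(2)[OF p(1)] by simp
    also have "\<dots> < M e" using \<epsilon> assms(3) by (simp add: M_def dot_square_norm)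
    finally show False using p(2)[OF eK] by simp
  qed
  then have ph: "p \<in> hemisphere e" using p(1) closure_hemisphere[OF assms(3)] by (auto simp: K_def)
  show False
  proof (rule no_interior_max_of_perturbed_height[OF C2 ph pde[OF ph] assms(2,4) _ \<epsilon>])
    show "\<alpha> > 0" using assms(1,4) by linarith
    show "exp (u y) * (e \<bullet> y) + \<epsilon> * exp (2 * u y) \<le> exp (u p) * (e \<bullet> p) + \<epsilon> * exp (2 * u p)"
      if "y \<in> hemisphere e" for y
      using p(2)[of y] that closure_subset[of "hemisphere e"] by (auto simp: M_def K_def)
  qed
qed

end
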